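(* Let $N$ be a positive integer, $S \subset \mathbb{Z}/N\mathbb{Z}$ a non-empty subset, and $\epsilon \in \{-1,1\}$. Then $$1 + \sum_{k=1}^\infty A_{S,N,\epsilon,k}(q) X^{2k} = \exp \left(2 \sum_{j=1}^\infty \frac{(-1)^{j-1}}{(2j)!} G_{S,N,\epsilon, 2j}(q) \left(2 \arcsin \frac{X}{2}\right)^{2j}\right),$$ which implies that, for every positive integer $k$, $$A_{S,N,\epsilon, k}(q) = \Lambda_k\bigl(G_{S,N,\epsilon, 2}(q), G_{S,N,\epsilon,4}(q), \dots, G_{S,N,\epsilon,2k}(q)\bigr).$$
   Context: For an integer $m$, "$m \in S$" means that the image of $m$ in $\mathbb{Z}/N\mathbb{Z}$ lies in $S$. For a positive integer $k$ and $\epsilon \in \{-1,1\}$, the generalized MacMahon functions are $$A_{S, N, \epsilon, k}(q) := \sum_{\substack{0 < m_1 < m_2 < \cdots < m_k \\ m_i \in S\ (1 \le i \le k)}} \frac{\epsilon^k q^{m_1 + m_2 + \cdots + m_k}}{(1 - \epsilon q^{m_1})^2 (1- \epsilon q^{m_2})^2 \cdots (1 - \epsilon q^{m_k})^2}.$$ The divisor sums and Eisenstein series are $$\sigma_{S,N,\epsilon, k}(n) := \sum_{\substack{d \mid n \\ n/d \in S}} \epsilon^d d^k, \qquad G_{S, N, \epsilon, k}(q) := \sum_{n=1}^\infty \sigma_{S,N,\epsilon,k-1}(n) q^n.$$ The polynomials $\Lambda_k(x_2, x_4, \dots, x_{2k}) \in \mathbb{Q}[x_2, x_4, \dots, x_{2k}]$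 are defined by the generating series $$1 + \sum_{k=1}^\infty \Lambda_k(x_2, x_4, \dots, x_{2k}) X^{2k} := \exp \left(2 \sum_{j=1}^\infty \frac{(-1)^{j-1}}{(2j)!} \left(2 \arcsin \frac{X}{2}\right)^{2j} x_{2j}\right).$$ *)

theory Defs
  imports
    "HOL-Computational_Algebra.Formal_Power_Series"
    "HOL-Library.Poly_Mapping"
    "HOL-Algebra.IntRing"
    "HOL-Analysis.Infinite_Sum"
begin

text \<open>
  All series are formal. A series in \<open>q\<close> has type \<^typ>\<open>rat fps\<close>, and a series in \<open>X\<close> over a
  commutative ring \<open>R\<close> has type \<open>R fps\<close>; so the generating function of the MacMahon series lives
  in \<^typ>\<open>rat fps fps\<close>, the inner variable being \<open>q\<close> and the outer one \<open>X\<close>. Infinite sums are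
  taken with \<^const>\<open>infsum\<close> in the adic topology of the library's metric on \<^type>\<open>fps\<close>.
\<close>

definition residue_in :: "nat \<Rightarrow> int set set \<Rightarrow> nat \<Rightarrow> bool" where
  "residue_in N S m \<longleftrightarrow> (Idl\<^bsub>\<Z>\<^esub> {int N}) +>\<^bsub>\<Z>\<^esub> (int m) \<in> S"

definition macmahon_index :: "nat \<Rightarrow> int set set \<Rightarrow> nat \<Rightarrow> nat list set" where
  "macmahon_index N S k =
     {ms. length ms = k \<and> sorted_wrt (<) ms \<and> (\<forall>m\<in>set ms. 0 < m \<and> residue_in N S m)}"

definition macmahon_term :: "rat \<Rightarrow> nat \<Rightarrow> nat list \<Rightarrow> rat fps" where
  "macmahon_term \<epsilon> k ms =
     fps_const (\<epsilon> ^ k) * fps_X ^ sum_list ms / (\<Prod>m\<leftarrow>ms. (1 - fps_const \<epsilon> * fps_X ^ m)\<^sup>2)"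

definition macmahon :: "nat \<Rightarrow> int set set \<Rightarrow> rat \<Rightarrow> nat \<Rightarrow> rat fps" where
  "macmahon N S \<epsilon> k = (\<Sum>\<^sub>\<infinity>ms\<in>macmahon_index N S k. macmahon_term \<epsilon> k ms)"

definition divisor_sum :: "nat \<Rightarrow> int set set \<Rightarrow> rat \<Rightarrow> nat \<Rightarrow> nat \<Rightarrow> rat" where
  "divisor_sum N S \<epsilon> k n = (\<Sum>d | d dvd n \<and> residue_in N S (n div d). \<epsilon> ^ d * of_nat d ^ k)"

definition eisenstein :: "nat \<Rightarrow> int set set \<Rightarrow> rat \<Rightarrow> nat \<Rightarrow> rat fps" where
  "eisenstein N S \<epsilon> k = Abs_fps (\<lambda>n. if n = 0 then 0 else divisor_sum N S \<epsilon> (k - 1) n)"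

text \<open>
  Base change of a rational power series along \<open>\<iota> : \<rat> \<rightarrow> R\<close>, and the exponential in \<open>R[[X]]\<close>
  of a series with zero constant term. (The library's \<^const>\<open>fps_exp\<close> requires the coefficients
  to form a field, which \<open>R = \<rat>[[q]]\<close> and \<open>R = \<rat>[x\<^sub>2, x\<^sub>4, \<dots>]\<close> do not.)
\<close>

definition fps_base_change :: "(rat \<Rightarrow> 'r) \<Rightarrow> rat fps \<Rightarrow> 'r fps" where
  "fps_base_change \<iota> f = Abs_fps (\<lambda>n. \<iota> (fps_nth f n))"

definition exp_series :: "(rat \<Rightarrow> 'r::comm_ring_1) \<Rightarrow> 'r fps \<Rightarrow> 'r fps" where
  "exp_series \<iota> f = fps_base_change \<iota> (fps_exp 1) oo f"

definition arcsin_series :: "rat fps" where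
  "arcsin_series = fps_inv (fps_sin 1)"

lemma arcsin_series_inverse: "arcsin_series oo fps_sin 1 = fps_X"
  unfolding arcsin_series_def by (rule fps_inv) (simp_all add: fps_sin_def)

definition two_arcsin_half :: "rat fps" where
  "two_arcsin_half = 2 * (arcsin_series oo (fps_const (1 / 2) * fps_X))"

text \<open>
  Polynomials over \<open>\<rat>\<close> in the variables \<open>x\<^sub>i\<close>: a monomial is a finitely supported exponent
  function, a polynomial a finitely supported coefficient function on monomials.
\<close>

type_synonym rat_mpoly = "(nat \<Rightarrow>\<^sub>0 nat) \<Rightarrow>\<^sub>0 rat"

definition mpoly_const :: "rat \<Rightarrow> rat_mpoly" where
  "mpoly_const c = Poly_Mapping.single 0 c"

definition mpoly_var :: "nat \<Rightarrow> rat_mpoly" where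
  "mpoly_var i = Poly_Mapping.single (Poly_Mapping.single i 1) 1"

definition mpoly_eval :: "(rat \<Rightarrow> 'r::comm_ring_1) \<Rightarrow> (nat \<Rightarrow> 'r) \<Rightarrow> rat_mpoly \<Rightarrow> 'r" where
  "mpoly_eval \<iota> v p =
     (\<Sum>m\<in>Poly_Mapping.keys p. \<iota> (Poly_Mapping.lookup p m) *
        (\<Prod>i\<in>Poly_Mapping.keys m. v i ^ Poly_Mapping.lookup m i))"

definition Lambda_poly :: "nat \<Rightarrow> rat_mpoly" where
  "Lambda_poly k = fps_nth
     (exp_series mpoly_const
       (2 * (\<Sum>\<^sub>\<infinity>j\<in>{1..}.
          fps_base_change mpoly_const
            (fps_const ((-1) ^ (j - 1) / fact (2 * j)) * two_arcsin_half ^ (2 * j))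
          * fps_const (mpoly_var (2 * j))))) (2 * k)"

text \<open>The families summed above, and the generating series in \<open>X\<close>, are summable, so that \<^const>\<open>infsum\<close> never takes its default value.\<close>

lemma fps_summable_onI:
  fixes f :: "'i \<Rightarrow> 'r::comm_ring_1 fps"
  assumes fin: "\<And>n. finite {i \<in> I. fps_nth (f i) n \<noteq> 0}"
  shows "f summable_on I"
  unfolding summable_on_def
  by (rule exI, rule has_sum_fpsI[OF fin, where S = "Abs_fps (\<lambda>n. \<Sum>i | i \<in> I \<and> fps_nth (f i) n \<noteq> 0. fps_nth (f i) n)"]) simp

lemma macmahon_summable: "macmahon_term \<epsilon> k summable_on macmahon_index N S k"
proof (rule fps_summable_onI)
  fix n
  have "set ms \<subseteq> {..n}"
    if ms: "ms \<in> macmahon_index N S k" and nz: "fps_nth (macmahon_term \<epsilon> k ms) n \<noteq> 0" for ms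
  proof -
    let ?D = "(\<Prod>m\<leftarrow>ms. (1 - fps_const \<epsilon> * fps_X ^ m)\<^sup>2)"
    have "fps_nth (\<Prod>m\<leftarrow>xs. (1 - fps_const \<epsilon> * fps_X ^ m)\<^sup>2) 0 = 1" if "\<forall>m\<in>set xs. 0 < m" for xs
      using that by (induction xs) (auto simp: power2_eq_square)
    then have "fps_nth ?D 0 \<noteq> 0"
      using ms by (auto simp: macmahon_index_def)
    then have "macmahon_term \<epsilon> k ms = fps_X ^ sum_list ms * (fps_const (\<epsilon> ^ k) * inverse ?D)"
      by (simp add: macmahon_term_def fps_divide_unit mult_ac)
    then have "sum_list ms \<le> n"
      using nz by (auto simp: fps_X_power_mult_nth not_less split: if_splits)
    then show ?thesis
      using member_le_sum_list[of _ ms] by fastforce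
  qed
  then have "{ms \<in> macmahon_index N S k. fps_nth (macmahon_term \<epsilon> k ms) n \<noteq> 0}
      \<subseteq> {ms. set ms \<subseteq> {..n} \<and> length ms = k}"
    by (auto simp: macmahon_index_def)
  then show "finite {ms \<in> macmahon_index N S k. fps_nth (macmahon_term \<epsilon> k ms) n \<noteq> 0}"
    by (rule finite_subset) (simp add: finite_lists_length_eq)
qed

lemma generating_series_summable:
  "(\<lambda>k. fps_const (a k) * fps_X ^ (2 * k) :: 'r::comm_ring_1 fps) summable_on {1..}"
proof (rule fps_summable_onI)
  fix n
  have "{k \<in> {1..}. fps_nth (fps_const (a k) * fps_X ^ (2 * k)) n \<noteq> 0} \<subseteq> {..n}"
    by (auto simp: fps_X_power_iff split: if_splits)
  then show "finite {k \<in> {1..}. fps_nth (fps_const (a k) * fps_X ^ (2 * k)) n \<noteq> 0}"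
    by (rule finite_subset) simp
qed

lemma two_arcsin_half_nth_0: "fps_nth two_arcsin_half 0 = 0"
  by (simp add: two_arcsin_half_def arcsin_series_def fps_inv_def)

lemma exponent_summable:
  fixes x :: "nat \<Rightarrow> 'r::comm_ring_1"
  assumes "\<iota> 0 = 0"
  shows "(\<lambda>j. fps_base_change \<iota> (fps_const (c j) * two_arcsin_half ^ (2 * j)) * fps_const (x j))
           summable_on {1..}"
proof (rule fps_summable_onI)
  fix n
  have "fps_nth (two_arcsin_half ^ (2 * j)) n = 0" if "n < j" for j
    using startsby_zero_power_prefix[OF two_arcsin_half_nth_0, of "2 * j"] that by auto
  then have "{j \<in> {1..}. fps_nth (fps_base_change \<iota> (fps_const (c j) * two_arcsin_half ^ (2 * j))
      * fps_const (x j)) n \<noteq> 0} \<subseteq> {..n}"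
  proof (intro subsetI)
    fix j assume "j \<in> {j \<in> {1..}. fps_nth (fps_base_change \<iota> (fps_const (c j) * two_arcsin_half ^ (2 * j))
      * fps_const (x j)) n \<noteq> 0}"
    then have "\<iota> (c j * fps_nth (two_arcsin_half ^ (2 * j)) n) \<noteq> 0"
      by (auto simp: fps_base_change_def)
    then have "fps_nth (two_arcsin_half ^ (2 * j)) n \<noteq> 0"
      using assms by (metis mult_zero_right)
    then show "j \<in> {..n}"
      using \<open>\<And>j. n < j \<Longrightarrow> fps_nth (two_arcsin_half ^ (2 * j)) n = 0\<close> by (auto simp: not_less[symmetric])
  qed
  then show "finite {j \<in> {1..}. fps_nth (fps_base_change \<iota> (fps_const (c j) * two_arcsin_half ^ (2 * j))
      * fps_const (x j)) n \<noteq> 0}"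
    by (rule finite_subset) simp
qed

end

theory Submission
  imports Defs
begin

text \<open>
  The left-hand side is a product over the parts. Write \<open>w\<^sub>m = \<epsilon>q\<^sup>m / (1 - \<epsilon>q\<^sup>m)\<^sup>2\<close>; choosing
  \<open>m\<^sub>1 < \<dots> < m\<^sub>k\<close> in \<open>S\<close> and multiplying the weights gives the \<open>k\<close>-th elementary symmetric function
  of the \<open>w\<^sub>m\<close>, so the generating series is the product of the factors \<open>1 + w\<^sub>m X\<^sup>2\<close> over all \<open>m > 0\<close>
  in \<open>S\<close>. On the right-hand side, sorting the divisor sums by the cofactor \<open>m = n / d\<close> writes
  \<open>G\<^sub>k\<close> as the sum over the same \<open>m\<close> of the series \<open>\<Sum>\<^sub>d d\<^bsup>k-1\<^esup> u\<^sup>d\<close> with \<open>u = \<epsilon>q\<^sup>m\<close>. The exponent is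
  linear in the \<open>G\<^sub>k\<close>, so the exponential is a product over \<open>m\<close> as well, and it suffices to
  compare the factors belonging to one \<open>m\<close> (\<open>macmahon_factor\<close>).

  For one factor substitute \<open>X = 2 sin (t/2)\<close>. Then \<open>X\<^sup>2 = 2 - 2 cos t\<close> and
  \<open>(1 - u)\<^sup>2 + u X\<^sup>2 = 1 - 2 u cos t + u\<^sup>2\<close>,
  the denominator of the Poisson kernel, while the exponent becomes
  \<open>2 \<Sum>\<^sub>j (-1)\<^bsup>j-1\<^esup> t\<^bsup>2j\<^esup> / (2j)! \<Sum>\<^sub>d d\<^bsup>2j-1\<^esup> u\<^sup>d = \<Sum>\<^sub>d (u\<^sup>d / d) (2 - 2 cos (dt))\<close>,
  which is the logarithm of that denominator divided by \<open>(1 - u)\<^sup>2\<close>. No logarithm is taken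
  below: both sides have the same logarithmic derivative in \<open>t\<close> (\<open>poisson_log_deriv\<close>), and this is
  the recurrence \<open>sin ((d+1)t) + sin ((d-1)t) = 2 cos t sin (dt)\<close> read off at each power of \<open>u\<close>.
  The identity is first proved for \<open>u = q\<close> and then carried to \<open>u = \<epsilon>q\<^sup>m\<close> by the ring homomorphism
  \<open>f(q) \<mapsto> f(u)\<close> acting on coefficients.

  The infinite product over \<open>m\<close> never appears, because a part \<open>m > n\<close> contributes nothing to the
  coefficient of \<open>q\<^sup>n\<close> on either side; for each \<open>n\<close> a finite product over \<open>m \<le> n\<close> suffices.

  The formula with the polynomials \<open>\<Lambda>\<^sub>k\<close> follows by evaluation at the Eisenstein series.
  Evaluation is a ring homomorphism, hence commutes with the exponential of power series, and
  only \<open>x\<^sub>2, \<dots>, x\<^bsub>2k\<^esub>\<close> influence the coefficient of \<open>X\<^bsup>2k\<^esup>\<close> since \<open>(2 arcsin (X/2))\<^bsup>2j\<^esup>\<close> starts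
  at \<open>X\<^bsup>2j\<^esup>\<close>.
\<close>

unbundle fps_syntax

section \<open>Homomorphisms on coefficients and the exponential\<close>

definition fps_map :: "('a \<Rightarrow> 'b) \<Rightarrow> 'a fps \<Rightarrow> 'b fps" where
  "fps_map h F = Abs_fps (\<lambda>n. h (F $ n))"

lemma fps_map_nth [simp]: "fps_map h F $ n = h (F $ n)"
  by (simp add: fps_map_def)

text \<open>
  Three homomorphisms move power series between coefficient rings: the inclusion of constants, the
  substitution \<open>q \<mapsto> u\<close>, and the evaluation of polynomials.
\<close>

locale ring_homomorphism =
  fixes h :: "'a::comm_ring_1 \<Rightarrow> 'b::comm_ring_1"
  assumes zero [simp]: "h 0 = 0"
    and one [simp]: "h 1 = 1"
    and add: "h (x + y) = h x + h y"
    and mult: "h (x * y) = h x * h y"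
begin

lemma sum: "h (sum f A) = (\<Sum>i\<in>A. h (f i))"
  by (induction A rule: infinite_finite_induct) (simp_all add: add)

lemma power: "h (x ^ n) = h x ^ n"
  by (induction n) (simp_all add: mult)

lemma of_nat: "h (of_nat n) = of_nat n"
  by (induction n) (simp_all add: add)

lemma numeral: "h (numeral n) = numeral n"
  using of_nat[of "numeral n"] by simp

lemma uminus: "h (- x) = - h x"
  using add[of x "- x"] by (simp add: eq_neg_iff_add_eq_0 add.commute)

lemma diff: "h (x - y) = h x - h y"
  using add[of x "- y"] by (simp add: uminus)

lemma map_fps: "ring_homomorphism (fps_map h)"
proof
  fix F G :: "'a fps"
  show "fps_map h (F * G) = fps_map h F * fps_map h G"
    by (simp add: fps_eq_iff fps_mult_nth sum mult)
qed (auto simp: fps_eq_iff add)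

lemma map_compose: "fps_map h (F oo G) = fps_map h F oo fps_map h G"
proof -
  interpret M: ring_homomorphism "fps_map h" by (rule map_fps)
  show ?thesis
    by (simp add: fps_eq_iff fps_compose_nth sum mult flip: M.power)
qed

lemma map_exp_series:
  assumes "\<And>c. h (\<iota> c) = \<kappa> c"
  shows "fps_map h (exp_series \<iota> F) = exp_series \<kappa> (fps_map h F)"
  unfolding exp_series_def map_compose
  by (simp add: fps_base_change_def fps_map_def assms)

end

lemma fps_const_homomorphism: "ring_homomorphism (fps_const :: 'a::comm_ring_1 \<Rightarrow> 'a fps)"
  by standard (simp_all add: fps_eq_iff)

lemma compose_homomorphism:
  fixes u :: "'a::idom fps"
  assumes "u $ 0 = 0"
  shows "ring_homomorphism (\<lambda>f. f oo u)"
  by standard (simp_all add: fps_compose_add_distrib fps_compose_mult_distrib assms)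

text \<open>
  Congruence modulo \<open>X\<^bsup>l+1\<^esup>\<close> and \<open>q\<^bsup>n+1\<^esup>\<close>. It is compatible with products, which is what allows the
  infinitely many parts and the infinitely many variables to be cut down to finitely many.
\<close>

definition coeff_agree :: "nat \<Rightarrow> nat \<Rightarrow> 'a::zero fps fps \<Rightarrow> 'a fps fps \<Rightarrow> bool" where
  "coeff_agree l n F G \<longleftrightarrow> (\<forall>i\<le>l. \<forall>j\<le>n. F $ i $ j = G $ i $ j)"

lemma coeff_agree_mult:
  fixes F G :: "'a::comm_ring_1 fps fps"
  assumes "coeff_agree l n F G" "coeff_agree l n F' G'"
  shows "coeff_agree l n (F * F') (G * G')"
  using assms by (auto simp: coeff_agree_def fps_mult_nth fps_sum_nth intro!: sum.cong)

lemma coeff_agree_power: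
  fixes F G :: "'a::comm_ring_1 fps fps"
  assumes "coeff_agree l n F G"
  shows "coeff_agree l n (F ^ k) (G ^ k)"
proof (induction k)
  case 0
  show ?case by (simp add: coeff_agree_def)
next
  case (Suc k)
  then show ?case using coeff_agree_mult[OF assms Suc] by simp
qed

lemma exp_series_coeff_cong:
  assumes "coeff_agree l n F G"
  shows "exp_series fps_const F $ l $ n = exp_series fps_const G $ l $ n"
proof -
  have "(F ^ i) $ l $ n = (G ^ i) $ l $ n" for i
    using coeff_agree_power[OF assms, of i] by (simp add: coeff_agree_def)
  then show ?thesis
    by (simp add: exp_series_def fps_compose_nth fps_sum_nth fps_base_change_def)
qed

lemma exp_series_nth_0: "exp_series fps_const F $ 0 = 1"
  by (simp add: exp_series_def fps_base_change_def fps_compose_nth)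

lemma exp_series_deriv:
  fixes F :: "rat fps fps"
  assumes "F $ 0 = 0"
  shows "fps_deriv (exp_series fps_const F) = exp_series fps_const F * fps_deriv F"
proof -
  have "fps_deriv (fps_base_change fps_const (fps_exp 1)) = fps_base_change fps_const (fps_exp (1::rat))"
    by (simp add: fps_eq_iff fps_base_change_def fps_of_nat[symmetric] del: of_nat_Suc)
  then show ?thesis
    by (simp add: exp_series_def fps_compose_deriv assms)
qed

text \<open>
  The functional equation of the exponential holds because the derivative of the product below
  vanishes; this form, without quotients, suits a coefficient ring that is not a field.
\<close>

lemma exp_series_minus:
  fixes F :: "rat fps fps"
  assumes "F $ 0 = 0"
  shows "exp_series fps_const F * exp_series fps_const (- F) = 1"
proof -
  let ?P = "exp_series fps_const F * exp_series fps_const (- F)"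
  have "fps_deriv ?P = 0"
    by (simp add: exp_series_deriv assms algebra_simps del: fps_deriv_eq_0_iff)
  then have "?P = fps_const (?P $ 0)"
    by (rule iffD1[OF fps_deriv_eq_0_iff])
  then show ?thesis
    by (simp add: exp_series_nth_0)
qed

lemma exp_series_add:
  fixes F G :: "rat fps fps"
  assumes "F $ 0 = 0" "G $ 0 = 0"
  shows "exp_series fps_const (F + G) = exp_series fps_const F * exp_series fps_const G"
proof -
  let ?P = "exp_series fps_const (F + G) * (exp_series fps_const (- F) * exp_series fps_const (- G))"
  have "fps_deriv ?P = 0"
    by (simp add: exp_series_deriv assms algebra_simps del: fps_deriv_eq_0_iff)
  then have "?P = fps_const (?P $ 0)"
    by (rule iffD1[OF fps_deriv_eq_0_iff])
  then have P: "?P = 1"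
    by (simp add: exp_series_nth_0)
  have "exp_series fps_const (F + G) = exp_series fps_const (F + G) *
      (exp_series fps_const F * exp_series fps_const (- F)) *
      (exp_series fps_const G * exp_series fps_const (- G))"
    by (simp add: exp_series_minus assms)
  also have "\<dots> = ?P * (exp_series fps_const F * exp_series fps_const G)"
    by (simp add: mult_ac)
  finally show ?thesis by (simp add: P)
qed

lemma exp_series_sum:
  fixes F :: "'i \<Rightarrow> rat fps fps"
  assumes "finite A" "\<And>i. i \<in> A \<Longrightarrow> F i $ 0 = 0"
  shows "exp_series fps_const (sum F A) = (\<Prod>i\<in>A. exp_series fps_const (F i))"
  using assms
proof (induction A rule: finite_induct)
  case empty
  have "exp_series fps_const (0 :: rat fps fps) = 1"
    using exp_series_minus[of 0] exp_series_add[of 0 0] by simp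
  then show ?case by simp
next
  case (insert i A)
  then show ?case by (simp add: exp_series_add fps_sum_nth)
qed

section \<open>Evaluation of polynomials\<close>

lemma monomial_eval_superset:
  assumes "finite A" "Poly_Mapping.keys m \<subseteq> A"
  shows "(\<Prod>i\<in>Poly_Mapping.keys m. v i ^ Poly_Mapping.lookup m i) =
    (\<Prod>i\<in>A. v i ^ Poly_Mapping.lookup m i :: 'r::comm_ring_1)"
  using assms by (intro prod.mono_neutral_left) (auto simp: in_keys_iff)

lemma monomial_eval_add:
  "(\<Prod>i\<in>Poly_Mapping.keys (m + m'). v i ^ Poly_Mapping.lookup (m + m') i) =
    (\<Prod>i\<in>Poly_Mapping.keys m. v i ^ Poly_Mapping.lookup m i) *
    (\<Prod>i\<in>Poly_Mapping.keys m'. v i ^ Poly_Mapping.lookup m' i :: 'r::comm_ring_1)"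
proof -
  let ?A = "Poly_Mapping.keys m \<union> Poly_Mapping.keys m'"
  have "(\<Prod>i\<in>Poly_Mapping.keys x. v i ^ Poly_Mapping.lookup x i) =
      (\<Prod>i\<in>?A. v i ^ Poly_Mapping.lookup x i)" if "Poly_Mapping.keys x \<subseteq> ?A" for x
    using that by (intro monomial_eval_superset) auto
  from this[OF Poly_Mapping.keys_add] this[of m] this[of m'] show ?thesis
    by (simp only: lookup_add power_add prod.distrib Un_upper1 Un_upper2)
qed

lemma poly_mapping_eq_sum_single:
  "p = (\<Sum>m\<in>Poly_Mapping.keys p. Poly_Mapping.single m (Poly_Mapping.lookup p m))"
  by (rule poly_mapping_eqI)
    (auto simp: lookup_sum lookup_single when_def in_keys_iff)

context
  fixes \<iota> :: "rat \<Rightarrow> 'r::comm_ring_1"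
  assumes \<iota>: "ring_homomorphism \<iota>"
begin

interpretation \<iota>: ring_homomorphism \<iota> by (rule \<iota>)

lemma mpoly_eval_single:
  "mpoly_eval \<iota> v (Poly_Mapping.single m a) =
    \<iota> a * (\<Prod>i\<in>Poly_Mapping.keys m. v i ^ Poly_Mapping.lookup m i)"
  by (cases "a = 0") (simp_all add: mpoly_eval_def)

lemma mpoly_eval_add: "mpoly_eval \<iota> v (p + p') = mpoly_eval \<iota> v p + mpoly_eval \<iota> v p'"
proof -
  let ?A = "Poly_Mapping.keys p \<union> Poly_Mapping.keys p'"
  have "mpoly_eval \<iota> v x = (\<Sum>m\<in>?A. \<iota> (Poly_Mapping.lookup x m) *
      (\<Prod>i\<in>Poly_Mapping.keys m. v i ^ Poly_Mapping.lookup m i))"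
    if "Poly_Mapping.keys x \<subseteq> ?A" for x
    unfolding mpoly_eval_def using that
    by (intro sum.mono_neutral_left) (auto simp: in_keys_iff)
  from this[OF Poly_Mapping.keys_add] this[of p] this[of p'] show ?thesis
    by (simp only: lookup_add \<iota>.add distrib_right sum.distrib Un_upper1 Un_upper2)
qed

lemma mpoly_eval_sum: "mpoly_eval \<iota> v (sum f A) = (\<Sum>i\<in>A. mpoly_eval \<iota> v (f i))"
  by (induction A rule: infinite_finite_induct) (simp_all add: mpoly_eval_add, simp_all add: mpoly_eval_def)

lemma mpoly_eval_homomorphism: "ring_homomorphism (mpoly_eval \<iota> v)"
proof
  fix p p' :: rat_mpoly
  show "mpoly_eval \<iota> v (p * p') = mpoly_eval \<iota> v p * mpoly_eval \<iota> v p'"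
  proof -
    let ?s = "\<lambda>p m. Poly_Mapping.single m (Poly_Mapping.lookup p m) :: rat_mpoly"
    have *: "mpoly_eval \<iota> v (?s p m * ?s p' m') = mpoly_eval \<iota> v (?s p m) * mpoly_eval \<iota> v (?s p' m')" for m m'
      by (simp add: mult_single mpoly_eval_single monomial_eval_add \<iota>.mult mult_ac)
    have "p * p' = (\<Sum>m\<in>Poly_Mapping.keys p. \<Sum>m'\<in>Poly_Mapping.keys p'. ?s p m * ?s p' m')"
      by (simp flip: sum_product poly_mapping_eq_sum_single)
    then have "mpoly_eval \<iota> v (p * p') = (\<Sum>m\<in>Poly_Mapping.keys p. mpoly_eval \<iota> v (?s p m)) *
        (\<Sum>m'\<in>Poly_Mapping.keys p'. mpoly_eval \<iota> v (?s p' m'))"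
      by (simp add: mpoly_eval_sum * sum_product)
    then show ?thesis
      by (simp flip: mpoly_eval_sum poly_mapping_eq_sum_single)
  qed
qed (simp_all add: mpoly_eval_add, simp_all add: mpoly_eval_def)

lemma mpoly_eval_const: "mpoly_eval \<iota> v (mpoly_const c) = \<iota> c"
  by (simp add: mpoly_const_def mpoly_eval_single)

lemma mpoly_eval_var: "mpoly_eval \<iota> v (mpoly_var i) = v i"
  by (simp add: mpoly_var_def mpoly_eval_single)

end

section \<open>The exponent of the generating series\<close>

text \<open>
  The coefficient ring is kept arbitrary so that the same series, taken over the polynomial ring
  with \<open>x\<close> the variables, is the exponent in the definition of \<open>\<Lambda>\<^sub>k\<close>.
\<close>

definition macmahon_exponent :: "(rat \<Rightarrow> 'r::comm_ring_1) \<Rightarrow> (nat \<Rightarrow> 'r) \<Rightarrow> 'r fps" where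
  "macmahon_exponent \<iota> x =
     2 * (\<Sum>\<^sub>\<infinity>j\<in>{1..}. fps_base_change \<iota>
           (fps_const ((-1) ^ (j - 1) / fact (2 * j)) * two_arcsin_half ^ (2 * j))
         * fps_const (x (2 * j)))"

lemma two_arcsin_half_power_nth: "n < j \<Longrightarrow> (two_arcsin_half ^ j) $ n = 0"
  using startsby_zero_power_prefix[OF two_arcsin_half_nth_0, of j] by auto

lemma infsum_fps_eqI:
  fixes f :: "'i \<Rightarrow> 'r::comm_ring_1 fps"
  assumes "\<And>n. finite (B n)" "\<And>n. B n \<subseteq> A"
    and "\<And>n i. i \<in> A - B n \<Longrightarrow> f i $ n = 0"
  shows "infsum f A $ n = (\<Sum>i\<in>B n. f i $ n)"
proof -
  have sub: "{i \<in> A. f i $ n \<noteq> 0} \<subseteq> B n" for n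
    using assms(3) by blast
  have "(f has_sum Abs_fps (\<lambda>n. \<Sum>i\<in>B n. f i $ n)) A"
  proof (rule has_sum_fpsI)
    show "finite {i \<in> A. f i $ n \<noteq> 0}" for n
      using sub assms(1) by (rule finite_subset)
    show "Abs_fps (\<lambda>n. \<Sum>i\<in>B n. f i $ n) $ n = (\<Sum>i | i \<in> A \<and> f i $ n \<noteq> 0. f i $ n)" for n
      using sub[of n] assms(1,2)[of n] by (auto intro!: sum.mono_neutral_right)
  qed
  then show ?thesis by (simp add: infsumI)
qed

text \<open>
  A finite formula for each coefficient: the terms with \<open>j > n\<close> vanish because
  \<open>2 arcsin (X/2)\<close> has no constant term.
\<close>

lemma macmahon_exponent_nth:
  assumes "\<iota> 0 = 0"
  shows "macmahon_exponent \<iota> x $ n =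
    (\<Sum>j=1..n. 2 * \<iota> ((-1) ^ (j - 1) / fact (2 * j) * (two_arcsin_half ^ (2 * j)) $ n) * x (2 * j))"
proof -
  define f where "f j = fps_base_change \<iota>
      (fps_const ((-1) ^ (j - 1) / fact (2 * j)) * two_arcsin_half ^ (2 * j)) * fps_const (x (2 * j))" for j
  have f_nth: "f j $ n = \<iota> ((-1) ^ (j - 1) / fact (2 * j) * (two_arcsin_half ^ (2 * j)) $ n) * x (2 * j)"
    for j n by (simp add: f_def fps_base_change_def)
  have "infsum f {1..} $ n = (\<Sum>j\<in>{1..n}. f j $ n)"
    by (rule infsum_fps_eqI) (auto simp: f_nth two_arcsin_half_power_nth assms)
  then have "macmahon_exponent \<iota> x $ n = 2 * (\<Sum>j\<in>{1..n}. f j $ n)"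
    by (simp add: macmahon_exponent_def f_def[abs_def] numeral_fps_const)
  then show ?thesis
    by (simp add: f_nth sum_distrib_left mult_ac)
qed

lemma macmahon_exponent_nth_0: "\<iota> 0 = 0 \<Longrightarrow> macmahon_exponent \<iota> x $ 0 = 0"
  by (simp add: macmahon_exponent_nth)

lemma macmahon_exponent_sum:
  assumes "\<iota> 0 = 0"
  shows "macmahon_exponent \<iota> (\<lambda>k. \<Sum>i\<in>A. x i k) = (\<Sum>i\<in>A. macmahon_exponent \<iota> (x i))"
proof (rule fps_ext)
  fix n
  show "macmahon_exponent \<iota> (\<lambda>k. \<Sum>i\<in>A. x i k) $ n = (\<Sum>i\<in>A. macmahon_exponent \<iota> (x i)) $ n"
    by (simp add: macmahon_exponent_nth assms fps_sum_nth sum_distrib_left sum.swap[of _ A])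
qed

lemma (in ring_homomorphism) map_macmahon_exponent:
  assumes "\<And>c. h (\<iota> c) = \<kappa> c" "\<iota> 0 = 0"
  shows "fps_map h (macmahon_exponent \<iota> x) = macmahon_exponent \<kappa> (\<lambda>k. h (x k))"
proof -
  have "\<kappa> 0 = 0" using assms by (metis zero)
  then show ?thesis
    by (simp add: fps_eq_iff macmahon_exponent_nth assms sum mult numeral)
qed

section \<open>The identity for a single part\<close>

text \<open>
  With \<open>t = 2 arcsin (X/2)\<close> this is the half-angle formula \<open>cos t = 1 - 2 sin\<^sup>2 (t/2)\<close>.
\<close>

lemma cos_two_arcsin_half: "fps_cos 1 oo two_arcsin_half = 1 - fps_const (1 / 2) * fps_X\<^sup>2"
proof -
  let ?Y = "arcsin_series oo (fps_const (1 / 2) * fps_X) :: rat fps"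
  have Y0: "?Y $ 0 = 0"
    by (simp add: arcsin_series_def fps_inv_def)
  have sinY: "fps_sin 1 oo ?Y = fps_const (1 / 2) * fps_X"
  proof -
    have "fps_sin 1 oo arcsin_series = (fps_X :: rat fps)"
      unfolding arcsin_series_def by (rule fps_inv_right) simp_all
    then show ?thesis
      by (subst fps_compose_assoc) (simp_all add: arcsin_series_def fps_inv_def)
  qed
  have two: "fps_cos 2 = 1 - 2 * (fps_sin (1::rat))\<^sup>2"
  proof -
    have "fps_cos 2 = (fps_cos 1)\<^sup>2 - (fps_sin (1::rat))\<^sup>2"
      using fps_cos_add[of 1 "1::rat"] by (simp add: power2_eq_square)
    also have "(fps_cos 1)\<^sup>2 = 1 - (fps_sin (1::rat))\<^sup>2"
      unfolding eq_diff_eq by (rule fps_sin_cos_sum_of_squares)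
    finally show ?thesis
      by (simp only: mult_2 diff_diff_eq)
  qed
  have "two_arcsin_half = (fps_const 2 * fps_X) oo ?Y"
    using Y0 by (simp add: two_arcsin_half_def fps_compose_mult_distrib numeral_fps_const)
  then have "fps_cos 1 oo two_arcsin_half = fps_cos 1 oo ((fps_const 2 * fps_X) oo ?Y)"
    by (rule arg_cong)
  also have "\<dots> = (fps_cos 1 oo (fps_const 2 * fps_X)) oo ?Y"
    by (rule fps_compose_assoc[OF Y0]) simp
  also have "fps_cos 1 oo (fps_const 2 * fps_X) = fps_cos (2::rat)"
    by (simp add: fps_compose_linear fps_eq_iff fps_cos_def)
  also have "fps_cos 2 oo ?Y = 1 - 2 * (fps_const (1 / 2) * fps_X)\<^sup>2"
    unfolding two using Y0
    by (simp add: fps_compose_sub_distrib fps_compose_mult_distrib sinY flip: fps_compose_power)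
  also have "\<dots> = 1 - fps_const (1 / 2) * fps_X\<^sup>2"
    by (simp add: fps_eq_iff numeral_fps_const power_mult_distrib fps_const_power
        mult.assoc[symmetric] power2_eq_square[of "1/2"])
  finally show ?thesis .
qed

text \<open>
  The coefficient of \<open>q\<^sup>d\<close> in a series in \<open>q\<close> and \<open>t\<close>, as a series in \<open>t\<close>. Series in \<open>t\<close> over
  \<open>\<rat>[[q]]\<close> can thus be compared one power of \<open>q\<close> at a time.
\<close>

definition column :: "nat \<Rightarrow> rat fps fps \<Rightarrow> rat fps" where
  "column d F = Abs_fps (\<lambda>n. F $ n $ d)"

lemma column_nth [simp]: "column d F $ n = F $ n $ d"
  by (simp add: column_def)

lemma column_eqI: "(\<And>d. column d F = column d G) \<Longrightarrow> F = G"
  by (simp add: fps_eq_iff)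

lemma column_simps:
  "column d (F + G) = column d F + column d G"
  "column d (F - G) = column d F - column d G"
  "column 0 (fps_const fps_X * F) = 0"
  "column (Suc d) (fps_const fps_X * F) = column d F"
  by (simp_all add: fps_eq_iff)

lemma column_deriv: "column d (fps_deriv F) = fps_deriv (column d F)"
  by (simp add: fps_eq_iff fps_of_nat[symmetric] del: of_nat_Suc)

lemma column_const_mult: "column d (fps_map fps_const f * F) = f * column d F"
  by (simp add: fps_eq_iff fps_mult_nth fps_sum_nth mult_delta_left)

lemma column_map_const: "column d (fps_map fps_const f) = (if d = 0 then f else 0)"
  by (simp add: fps_eq_iff)

lemma fps_deriv_map_const: "fps_deriv (fps_map fps_const f) = fps_map fps_const (fps_deriv f)"
  by (simp add: fps_eq_iff fps_of_nat[symmetric] del: of_nat_Suc)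

text \<open>
  The series \<open>\<Sum>\<^sub>d (q\<^sup>d / d) (2 - 2 cos (dt))\<close>. The term \<open>d = 0\<close> vanishes because \<open>2 / 0 = 0\<close>.
\<close>

definition poisson_log :: "rat fps fps" where
  "poisson_log = Abs_fps (\<lambda>n. Abs_fps (\<lambda>d. (fps_const (2 / of_nat d) * (1 - fps_cos (of_nat d))) $ n))"

text \<open>In terms of \<open>e\<^bsup>it\<^esup>\<close>, the product \<open>(1 - q e\<^bsup>it\<^esup>) (1 - q e\<^bsup>-it\<^esup>) = 1 - 2 q cos t + q\<^sup>2\<close>.\<close>

definition poisson_denominator :: "rat fps fps" where
  "poisson_denominator =
     1 - fps_const fps_X * (2 * fps_map fps_const (fps_cos 1)) + fps_const fps_X * fps_const fps_X"

lemma poisson_log_nth_0: "poisson_log $ 0 = 0"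
  by (simp add: poisson_log_def fps_eq_iff)

lemma column_poisson_log_deriv: "column d (fps_deriv poisson_log) = 2 * fps_sin (of_nat d)"
proof -
  have "column d poisson_log = fps_const (2 / of_nat d) * (1 - fps_cos (of_nat d))"
    by (simp add: fps_eq_iff poisson_log_def)
  then show ?thesis
    by (cases "d = 0") (simp_all add: column_deriv fps_cos_deriv numeral_fps_const flip: fps_const_neg)
qed

lemma fps_sin_recurrence:
  fixes a :: "'a::field_char_0"
  shows "fps_sin (a + 1) + fps_sin (a - 1) = 2 * (fps_cos 1 * fps_sin a)"
  using fps_sin_add[of a 1] fps_sin_add[of a "-1"] by (simp add: fps_sin_even fps_cos_odd)

text \<open>
  The derivative of the logarithm is \<open>2 \<Sum>\<^sub>d q\<^sup>d sin (dt)\<close>. At \<open>q\<^sup>d\<close> with \<open>d \<ge> 2\<close> the product on the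
  left has coefficient \<open>2 sin (dt) - 4 cos t sin ((d-1)t) + 2 sin ((d-2)t)\<close>, which vanishes by the
  recurrence; at \<open>q\<close> the coefficient \<open>2 sin t\<close> remains.
\<close>

lemma poisson_log_deriv: "poisson_denominator * fps_deriv poisson_log = fps_deriv poisson_denominator"
proof (rule column_eqI)
  fix d
  let ?q = "fps_const fps_X :: rat fps fps" and ?c = "fps_map fps_const (fps_cos 1) :: rat fps fps"
  let ?L = "fps_deriv poisson_log"
  have c: "2 * ?c = fps_map fps_const (2 * fps_cos 1)"
    by (simp add: fps_eq_iff numeral_fps_const)
  have lhs: "poisson_denominator * ?L = ?L - ?q * (fps_map fps_const (2 * fps_cos 1) * ?L) + ?q * (?q * ?L)"
    by (simp add: poisson_denominator_def c algebra_simps)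
  have "fps_deriv (fps_map fps_const (2 * fps_cos 1)) = - fps_map fps_const (2 * fps_sin (1::rat)) "
    by (simp add: fps_deriv_map_const fps_cos_deriv flip: fps_const_neg) (simp add: fps_eq_iff)
  then have rhs: "fps_deriv poisson_denominator = ?q * fps_map fps_const (2 * fps_sin 1)"
    by (simp add: poisson_denominator_def c)
  consider "d = 0" | "d = 1" | e where "d = Suc (Suc e)"
    by (metis One_nat_def not0_implies_Suc)
  then show "column d (poisson_denominator * ?L) = column d (fps_deriv poisson_denominator)"
  proof cases
    case 3
    let ?e = "of_nat e :: rat"
    have ring: "2 * a - 2 * c * (2 * b) + 2 * a' = 2 * ((a + a') - 2 * (c * b))" for a a' b c :: "rat fps"
      by (simp add: algebra_simps)
    have "2 * fps_sin (?e + 2) - 2 * fps_cos 1 * (2 * fps_sin (?e + 1)) + 2 * fps_sin ?e =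
        2 * ((fps_sin (?e + 2) + fps_sin ?e) - 2 * (fps_cos 1 * fps_sin (?e + 1)))"
      by (rule ring)
    also have "fps_sin (?e + 2) + fps_sin ?e = 2 * (fps_cos 1 * fps_sin (?e + 1))"
      using fps_sin_recurrence[of "?e + 1"] by (simp add: add.assoc)
    finally have "2 * fps_sin (?e + 2) - 2 * fps_cos 1 * (2 * fps_sin (?e + 1)) + 2 * fps_sin ?e = 0"
      by simp
    moreover have "of_nat (Suc e) = ?e + 1" "of_nat (Suc (Suc e)) = ?e + 2"
      by simp_all
    ultimately show ?thesis
      by (simp only: lhs rhs 3 column_simps column_const_mult column_poisson_log_deriv column_map_const) simp
  qed (simp_all add: lhs rhs column_simps column_const_mult column_poisson_log_deriv column_map_const)
qed

text \<open>
  Multiplying the denominator \<open>D\<close> by the inverse exponential yields a series with derivative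
  \<open>(D' - D L') exp (-L) = 0\<close>, hence the constant \<open>(1 - q)\<^sup>2\<close>, which is the value of \<open>D\<close> at \<open>t = 0\<close>.
\<close>

lemma exp_poisson_log: "poisson_denominator = fps_const ((1 - fps_X)\<^sup>2) * exp_series fps_const poisson_log"
proof -
  let ?P = "poisson_denominator * exp_series fps_const (- poisson_log)"
  have "fps_deriv ?P =
      (fps_deriv poisson_denominator - poisson_denominator * fps_deriv poisson_log) *
        exp_series fps_const (- poisson_log)"
    by (simp add: exp_series_deriv poisson_log_nth_0 algebra_simps del: fps_deriv_eq_0_iff)
  then have "fps_deriv ?P = 0"
    by (simp add: poisson_log_deriv)
  then have "?P = fps_const (?P $ 0)"
    by (rule iffD1[OF fps_deriv_eq_0_iff])
  also have "?P $ 0 = (1 - fps_X)\<^sup>2"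
    by (simp add: exp_series_nth_0 poisson_denominator_def power2_eq_square algebra_simps numeral_fps_const)
  finally have P: "?P = fps_const ((1 - fps_X)\<^sup>2)" .
  have "poisson_denominator =
      poisson_denominator * (exp_series fps_const poisson_log * exp_series fps_const (- poisson_log))"
    by (simp add: exp_series_minus poisson_log_nth_0)
  also have "\<dots> = ?P * exp_series fps_const poisson_log"
    by (simp add: mult_ac)
  finally show ?thesis
    by (simp add: P)
qed

text \<open>
  The polylogarithm of order \<open>1 - k\<close>, for \<open>k \<ge> 2\<close>; there the coefficient at \<open>d = 0\<close> is \<open>0\<close>.
\<close>

definition polylog_series :: "nat \<Rightarrow> rat fps" where
  "polylog_series k = Abs_fps (\<lambda>d. of_nat d ^ (k - 1))"

text \<open>
  Expanding the cosines in powers of \<open>t\<close> and exchanging the two sums collects, at \<open>t\<^bsup>2j\<^esup>\<close>, the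
  series \<open>\<Sum>\<^sub>d d\<^bsup>2j-1\<^esup> q\<^sup>d\<close>.
\<close>

lemma poisson_log_compose:
  "poisson_log oo fps_map fps_const two_arcsin_half = macmahon_exponent fps_const polylog_series"
proof (rule fps_ext)
  fix n
  interpret M: ring_homomorphism "fps_map (fps_const :: rat \<Rightarrow> rat fps)"
    by (intro ring_homomorphism.map_fps fps_const_homomorphism)
  have L: "poisson_log $ (2 * j) = 2 * fps_const ((-1) ^ (j - 1) / fact (2 * j)) * polylog_series (2 * j)"
    if "j \<ge> 1" for j
  proof (rule fps_ext)
    fix d
    obtain i where j: "j = Suc i" using \<open>j \<ge> 1\<close> by (cases j) auto
    show "poisson_log $ (2 * j) $ d =
        (2 * fps_const ((-1) ^ (j - 1) / fact (2 * j)) * polylog_series (2 * j)) $ d"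
      by (cases "d = 0")
        (simp_all add: poisson_log_def polylog_series_def j fps_cos_def numeral_fps_const field_simps del: fact_Suc)
  qed
  have odd: "poisson_log $ i = 0" if "odd i" for i
    using that odd_pos[OF that] by (auto simp: poisson_log_def fps_eq_iff fps_cos_def)
  let ?t = "\<lambda>i. poisson_log $ i * fps_const ((two_arcsin_half ^ i) $ n)"
  have "(poisson_log oo fps_map fps_const two_arcsin_half) $ n = (\<Sum>i=0..n. ?t i)"
    by (simp add: fps_compose_nth flip: M.power)
  also have "\<dots> = (\<Sum>i\<in>(\<lambda>j. 2 * j) ` {1..n}. ?t i)"
  proof (rule sum.mono_neutral_cong)
    show "?t i = 0" if "i \<in> (\<lambda>j. 2 * j) ` {1..n} - {0..n}" for i
      using that by (auto simp: two_arcsin_half_power_nth)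
    show "?t i = 0" if "i \<in> {0..n} - (\<lambda>j. 2 * j) ` {1..n}" for i
    proof (cases "i = 0 \<or> odd i")
      case True
      then show ?thesis by (auto simp: odd poisson_log_nth_0)
    next
      case False
      then have "i = 2 * (i div 2)" "i div 2 \<in> {1..n}" using that by auto
      then show ?thesis using that by blast
    qed
  qed auto
  also have "\<dots> = (\<Sum>j=1..n. ?t (2 * j))"
    by (subst sum.reindex) (auto intro: inj_onI)
  also have "\<dots> = macmahon_exponent fps_const polylog_series $ n"
    unfolding macmahon_exponent_nth[of fps_const, OF fps_const_0_eq_0]
  proof (rule sum.cong)
    fix j assume "j \<in> {1..n}"
    then have "j \<ge> 1" by simp
    show "?t (2 * j) = 2 * fps_const ((-1) ^ (j - 1) / fact (2 * j) * (two_arcsin_half ^ (2 * j)) $ n) *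
        polylog_series (2 * j)"
      unfolding L[OF \<open>j \<ge> 1\<close>] by (simp add: mult_ac)
  qed simp
  finally show "(poisson_log oo fps_map fps_const two_arcsin_half) $ n = \<dots>" .
qed

lemma exp_polylog:
  "fps_const ((1 - fps_X)\<^sup>2) + fps_const fps_X * fps_X\<^sup>2 =
     fps_const ((1 - fps_X)\<^sup>2) * exp_series fps_const (macmahon_exponent fps_const polylog_series)"
proof -
  interpret C: ring_homomorphism "fps_const :: rat \<Rightarrow> rat fps"
    by (rule fps_const_homomorphism)
  let ?\<tau> = "fps_map fps_const two_arcsin_half :: rat fps fps"
  have \<tau>0: "?\<tau> $ 0 = 0" by (simp add: two_arcsin_half_nth_0)
  have "fps_map fps_const (fps_cos 1) oo ?\<tau> = fps_map fps_const (1 - fps_const (1 / 2) * fps_X\<^sup>2)"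
    by (simp only: cos_two_arcsin_half flip: C.map_compose)
  then have cos: "2 * fps_map fps_const (fps_cos 1) oo ?\<tau> = 2 - (fps_X\<^sup>2 :: rat fps fps)"
    using \<tau>0 by (simp add: fps_compose_mult_distrib) (simp add: fps_eq_iff numeral_fps_const)
  have "poisson_denominator oo ?\<tau> = 1 - fps_const fps_X * (2 - fps_X\<^sup>2) + fps_const fps_X * fps_const fps_X"
    using \<tau>0 unfolding poisson_denominator_def fps_compose_add_distrib fps_compose_sub_distrib
    by (simp add: fps_compose_mult_distrib[of ?\<tau> "fps_const fps_X"] cos del: fps_const_mult)
  also have "\<dots> = fps_const ((1 - fps_X)\<^sup>2) + fps_const fps_X * fps_X\<^sup>2"
    by (simp add: power2_eq_square algebra_simps numeral_fps_const
        flip: fps_const_mult fps_const_add fps_const_sub)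
  finally have "fps_const ((1 - fps_X)\<^sup>2) + fps_const fps_X * fps_X\<^sup>2 = poisson_denominator oo ?\<tau>" by simp
  also have "\<dots> = fps_const ((1 - fps_X)\<^sup>2) * (exp_series fps_const poisson_log oo ?\<tau>)"
    using \<tau>0 by (subst exp_poisson_log) (simp add: fps_compose_mult_distrib)
  also have "exp_series fps_const poisson_log oo ?\<tau> =
      exp_series fps_const (macmahon_exponent fps_const polylog_series)"
    unfolding exp_series_def poisson_log_compose[symmetric]
    using \<tau>0 poisson_log_nth_0 by (simp add: fps_compose_assoc)
  finally show ?thesis .
qed

text \<open>
  The case \<open>u = q\<close> is universal: substituting \<open>u\<close> for \<open>q\<close> in all coefficients fixes \<open>X\<close> and
  commutes with the exponential. Then \<open>(1 - u)\<^sup>2\<close>, being invertible, can be divided out.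
\<close>

lemma macmahon_factor:
  fixes u :: "rat fps"
  assumes "u $ 0 = 0"
  shows "1 + fps_const (u * inverse ((1 - u)\<^sup>2)) * fps_X\<^sup>2 =
    exp_series fps_const (macmahon_exponent fps_const (\<lambda>k. polylog_series k oo u))"
proof -
  interpret U: ring_homomorphism "\<lambda>f. f oo u"
    using assms by (rule compose_homomorphism)
  interpret M: ring_homomorphism "fps_map (\<lambda>f. f oo u)"
    by (rule U.map_fps)
  let ?E = "exp_series fps_const (macmahon_exponent fps_const (\<lambda>k. polylog_series k oo u))"
  have const: "fps_map (\<lambda>f. f oo u) (fps_const a) = fps_const (a oo u)" for a
    by (simp add: fps_eq_iff)
  have X: "fps_map (\<lambda>f. f oo u) fps_X = fps_X"
    by (simp add: fps_eq_iff fps_X_def)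
  have q: "(1 - fps_X)\<^sup>2 oo u = (1 - u)\<^sup>2"
    using assms by (simp add: U.power U.diff)
  have "fps_const ((1 - u)\<^sup>2) + fps_const u * fps_X\<^sup>2 = fps_const ((1 - u)\<^sup>2) * ?E"
    using arg_cong[OF exp_polylog, of "fps_map (\<lambda>f. f oo u)"] assms
    by (simp add: M.add M.mult M.power const X q U.map_exp_series U.map_macmahon_exponent
        del: fps_const_power)
  then have "fps_const (inverse ((1 - u)\<^sup>2)) * (fps_const ((1 - u)\<^sup>2) + fps_const u * fps_X\<^sup>2) =
      fps_const (inverse ((1 - u)\<^sup>2)) * (fps_const ((1 - u)\<^sup>2) * ?E)"
    by simp
  moreover have "inverse ((1 - u)\<^sup>2) * (1 - u)\<^sup>2 = 1"
    by (rule inverse_mult_eq_1) (simp add: assms power2_eq_square)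
  then have "fps_const (inverse ((1 - u)\<^sup>2)) * fps_const ((1 - u)\<^sup>2) = 1"
    by (simp del: fps_const_power)
  moreover have "fps_const (u * inverse ((1 - u)\<^sup>2)) = fps_const (inverse ((1 - u)\<^sup>2)) * fps_const u"
    by (simp add: mult.commute)
  ultimately show ?thesis
    by (simp add: distrib_left mult.assoc[symmetric] del: fps_const_power fps_const_mult)
qed

section \<open>The MacMahon series as elementary symmetric functions\<close>

definition part_weight :: "rat \<Rightarrow> nat \<Rightarrow> rat fps" where
  "part_weight \<epsilon> m = fps_const \<epsilon> * fps_X ^ m * inverse ((1 - fps_const \<epsilon> * fps_X ^ m)\<^sup>2)"

definition small_parts :: "nat \<Rightarrow> int set set \<Rightarrow> nat \<Rightarrow> nat set" where
  "small_parts N S n = {m \<in> {1..n}. residue_in N S m}"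

lemma finite_small_parts [simp]: "finite (small_parts N S n)"
  by (simp add: small_parts_def)

lemma macmahon_term_eq_prod_weights:
  assumes "ms \<in> macmahon_index N S k"
  shows "macmahon_term \<epsilon> k ms = (\<Prod>m\<in>set ms. part_weight \<epsilon> m)"
proof -
  let ?D = "\<lambda>m. (1 - fps_const \<epsilon> * fps_X ^ m :: rat fps)\<^sup>2"
  have ms: "length ms = k" "sorted_wrt (<) ms" "\<forall>m\<in>set ms. 0 < m"
    using assms by (auto simp: macmahon_index_def)
  have weights: "fps_const (\<epsilon> ^ length xs) * fps_X ^ sum_list xs * inverse (\<Prod>m\<leftarrow>xs. ?D m) =
      (\<Prod>m\<leftarrow>xs. part_weight \<epsilon> m)" for xs
  proof (induction xs)
    case (Cons m xs)
    have "fps_const (\<epsilon> ^ length (m # xs)) * fps_X ^ sum_list (m # xs) *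
          inverse (\<Prod>m\<leftarrow>m # xs. ?D m) =
        part_weight \<epsilon> m *
          (fps_const (\<epsilon> ^ length xs) * fps_X ^ sum_list xs * inverse (\<Prod>m\<leftarrow>xs. ?D m))"
      by (simp add: part_weight_def fps_inverse_mult power_add mult_ac flip: fps_const_mult)
    then show ?case using Cons by simp
  qed simp
  have "fps_nth (\<Prod>m\<leftarrow>xs. ?D m) 0 = 1" if "\<forall>m\<in>set xs. 0 < m" for xs
    using that by (induction xs) (auto simp: power2_eq_square)
  then have "macmahon_term \<epsilon> k ms =
      fps_const (\<epsilon> ^ length ms) * fps_X ^ sum_list ms * inverse (\<Prod>m\<leftarrow>ms. ?D m)"
    using ms by (simp add: macmahon_term_def fps_divide_unit)
  also have "\<dots> = (\<Prod>m\<leftarrow>ms. part_weight \<epsilon> m)"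
    by (rule weights)
  also have "\<dots> = (\<Prod>m\<in>set ms. part_weight \<epsilon> m)"
    using ms(2) strict_sorted_iff by (metis prod.distinct_set_conv_list)
  finally show ?thesis .
qed

lemma prod_weights_nth_eq_0:
  assumes "finite A" "m \<in> A" "n < m"
  shows "(\<Prod>m\<in>A. part_weight \<epsilon> m) $ n = 0"
proof -
  have "(\<Prod>m\<in>A. part_weight \<epsilon> m) = fps_X ^ m *
      (fps_const \<epsilon> * inverse ((1 - fps_const \<epsilon> * fps_X ^ m)\<^sup>2) * (\<Prod>m\<in>A - {m}. part_weight \<epsilon> m))"
    using assms by (subst prod.remove[of A m]) (simp_all add: part_weight_def mult_ac)
  then show ?thesis
    using assms by (simp add: fps_X_power_mult_nth)
qed

text \<open>
  Increasing lists of parts are the same as finite sets of parts, and a set containing a part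
  greater than \<open>n\<close> contributes a multiple of \<open>q\<^bsup>n+1\<^esup>\<close>.
\<close>

lemma macmahon_nth:
  "macmahon N S \<epsilon> k $ n =
    (\<Sum>A | A \<subseteq> small_parts N S n \<and> card A = k. (\<Prod>m\<in>A. part_weight \<epsilon> m) $ n)"
proof -
  let ?B = "\<lambda>n. {ms \<in> macmahon_index N S k. set ms \<subseteq> {..n}}"
  have "macmahon N S \<epsilon> k $ n = (\<Sum>ms\<in>?B n. macmahon_term \<epsilon> k ms $ n)"
    unfolding macmahon_def
  proof (rule infsum_fps_eqI)
    show "finite (?B n)" for n
      by (rule finite_subset[OF _ finite_lists_length_eq[of "{..n}" k]])
        (auto simp: macmahon_index_def)
    show "macmahon_term \<epsilon> k ms $ n = 0" if ms: "ms \<in> macmahon_index N S k - ?B n" for n ms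
    proof -
      have "\<not> set ms \<subseteq> {..n}" using ms by blast
      then obtain m where "m \<in> set ms" "n < m" by (meson atMost_iff not_le subsetI)
      moreover have "ms \<in> macmahon_index N S k" using ms by simp
      ultimately show ?thesis
        by (simp only: macmahon_term_eq_prod_weights) (rule prod_weights_nth_eq_0; simp)
    qed
  qed auto
  also have "\<dots> = (\<Sum>A | A \<subseteq> small_parts N S n \<and> card A = k. (\<Prod>m\<in>A. part_weight \<epsilon> m) $ n)"
  proof (rule sum.reindex_bij_witness[of _ sorted_list_of_set set])
    fix ms assume ms: "ms \<in> ?B n"
    then have srt: "sorted_wrt (<) ms" by (simp add: macmahon_index_def)
    show "sorted_list_of_set (set ms) = ms"
      using srt by (simp add: strict_sorted_iff sorted_list_of_set.idem_if_sorted_distinct)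
    show "set ms \<in> {A. A \<subseteq> small_parts N S n \<and> card A = k}"
      using ms srt by (auto simp: macmahon_index_def small_parts_def Suc_le_eq strict_sorted_iff distinct_card)
    show "(\<Prod>m\<in>set ms. part_weight \<epsilon> m) $ n = macmahon_term \<epsilon> k ms $ n"
      using ms macmahon_term_eq_prod_weights[of ms N S k \<epsilon>] by simp
  next
    fix A assume A: "A \<in> {A. A \<subseteq> small_parts N S n \<and> card A = k}"
    then have "finite A" using finite_subset[OF _ finite_small_parts] by blast
    with A show "set (sorted_list_of_set A) = A" "sorted_list_of_set A \<in> ?B n"
      by (auto simp: macmahon_index_def small_parts_def)
  qed
  finally show ?thesis .
qed

lemma prod_one_plus_square_nth:
  fixes w :: "'i \<Rightarrow> 'r::comm_ring_1"
  assumes "finite T"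
  shows "(\<Prod>m\<in>T. 1 + fps_const (w m) * fps_X\<^sup>2) $ l =
    (if even l then \<Sum>A | A \<subseteq> T \<and> card A = l div 2. \<Prod>m\<in>A. w m else 0)"
proof -
  have const: "(\<Prod>m\<in>A. fps_const (w m)) = fps_const (\<Prod>m\<in>A. w m)" for A
    by (induction A rule: infinite_finite_induct) simp_all
  have "(\<Prod>m\<in>T. 1 + fps_const (w m) * fps_X\<^sup>2) = (\<Sum>A\<in>Pow T. fps_const (\<Prod>m\<in>A. w m) * fps_X ^ (2 * card A))"
    using prod_add[OF assms, of "\<lambda>m. fps_const (w m) * fps_X\<^sup>2" "\<lambda>_. 1"]
    by (simp add: add.commute prod.distrib const power_mult)
  then have "(\<Prod>m\<in>T. 1 + fps_const (w m) * fps_X\<^sup>2) $ l =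
      (\<Sum>A\<in>Pow T. if l = 2 * card A then \<Prod>m\<in>A. w m else 0)"
    by (auto simp: fps_sum_nth intro!: sum.cong)
  also have "\<dots> = (\<Sum>A | A \<subseteq> T \<and> l = 2 * card A. \<Prod>m\<in>A. w m)"
    using assms by (simp add: sum.inter_filter[symmetric] Pow_def)
  also have "\<dots> = (if even l then \<Sum>A | A \<subseteq> T \<and> card A = l div 2. \<Prod>m\<in>A. w m else 0)"
  proof (cases "even l")
    case True
    then have "l = 2 * card A \<longleftrightarrow> card A = l div 2" for A :: "'i set" by auto
    then show ?thesis using True by simp
  next
    case False
    then have none: "{A. A \<subseteq> T \<and> l = 2 * card A} = {}" by auto
    show ?thesis unfolding none using False by simp
  qed
  finally show ?thesis .
qed

lemma even_series_nth:
  fixes a :: "nat \<Rightarrow> 'r::comm_ring_1"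
  shows "(1 + (\<Sum>\<^sub>\<infinity>k\<in>{1..}. fps_const (a k) * fps_X ^ (2 * k))) $ l =
    (if l = 0 then 1 else if even l then a (l div 2) else 0)"
proof -
  have "(\<Sum>\<^sub>\<infinity>k\<in>{1..}. fps_const (a k) * fps_X ^ (2 * k)) $ l =
      (\<Sum>k\<in>{1..l}. (fps_const (a k) * fps_X ^ (2 * k)) $ l)"
    by (rule infsum_fps_eqI) auto
  also have "\<dots> = (\<Sum>k\<in>{1..l}. if k = l div 2 then (if even l then a (l div 2) else 0) else 0)"
    by (rule sum.cong) (auto simp: mult_delta_right)
  also have "\<dots> = (if l div 2 \<in> {1..l} \<and> even l then a (l div 2) else 0)"
    by simp
  finally show ?thesis by auto
qed

lemma macmahon_series_nth:
  "(1 + (\<Sum>\<^sub>\<infinity>k\<in>{1..}. fps_const (macmahon N S \<epsilon> k) * fps_X ^ (2 * k))) $ l $ n =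
    (\<Prod>m\<in>small_parts N S n. 1 + fps_const (part_weight \<epsilon> m) * fps_X\<^sup>2) $ l $ n"
proof (cases "l = 0")
  case True
  have "{A. A \<subseteq> small_parts N S n \<and> card A = 0} = {{}}"
    using finite_subset[OF _ finite_small_parts] by (auto simp: card_eq_0_iff)
  then show ?thesis
    unfolding True even_series_nth prod_one_plus_square_nth[OF finite_small_parts] by simp
next
  case False
  then show ?thesis
    unfolding even_series_nth prod_one_plus_square_nth[OF finite_small_parts]
    by (simp add: macmahon_nth fps_sum_nth)
qed

section \<open>The Eisenstein series as sums over parts\<close>

lemma polylog_series_compose_nth:
  assumes "m > 0"
  shows "(polylog_series k oo (fps_const \<epsilon> * fps_X ^ m)) $ n =
    (if m dvd n then \<epsilon> ^ (n div m) * of_nat (n div m) ^ (k - 1) else 0)"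
proof -
  have "(polylog_series k oo (fps_const \<epsilon> * fps_X ^ m)) $ n =
      (\<Sum>d=0..n. if n = m * d then \<epsilon> ^ d * of_nat d ^ (k - 1) else 0)"
    by (simp add: fps_compose_nth polylog_series_def power_mult_distrib mult_delta_right
        flip: power_mult) (simp add: mult.commute if_distrib cong: if_cong)
  also have "\<dots> = (\<Sum>d=0..n. if d = n div m then
      (if m dvd n then \<epsilon> ^ (n div m) * of_nat (n div m) ^ (k - 1) else 0) else 0)"
    using assms by (intro sum.cong) auto
  also have "\<dots> = (if m dvd n then \<epsilon> ^ (n div m) * of_nat (n div m) ^ (k - 1) else 0)"
    by simp
  finally show ?thesis .
qed

text \<open>
  The divisors \<open>d\<close> of \<open>i\<close> with \<open>i / d \<in> S\<close> correspond to the parts \<open>m = i / d\<close> dividing \<open>i\<close>. The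
  bound \<open>k \<ge> 2\<close> makes the constant terms agree: \<open>0\<^bsup>k-1\<^esup> = 0\<close>.
\<close>

lemma eisenstein_nth_eq_sum_parts:
  assumes "k \<ge> 2" "i \<le> n"
  shows "eisenstein N S \<epsilon> k $ i =
    (\<Sum>m\<in>small_parts N S n. polylog_series k oo (fps_const \<epsilon> * fps_X ^ m)) $ i"
proof -
  let ?T = "small_parts N S n"
  have pos: "m > 0" if "m \<in> ?T" for m using that by (auto simp: small_parts_def)
  have "(\<Sum>m\<in>?T. polylog_series k oo (fps_const \<epsilon> * fps_X ^ m)) $ i =
      (\<Sum>m\<in>?T. if m dvd i then \<epsilon> ^ (i div m) * of_nat (i div m) ^ (k - 1) else 0)"
    unfolding fps_sum_nth by (intro sum.cong refl polylog_series_compose_nth pos)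
  also have "\<dots> = (\<Sum>m | m \<in> ?T \<and> m dvd i. \<epsilon> ^ (i div m) * of_nat (i div m) ^ (k - 1))"
    by (rule sum.inter_filter[symmetric]) simp
  also have "\<dots> = eisenstein N S \<epsilon> k $ i"
  proof (cases "i = 0")
    case True
    then show ?thesis using assms by (simp add: eisenstein_def)
  next
    case False
    have "(\<Sum>m | m \<in> ?T \<and> m dvd i. \<epsilon> ^ (i div m) * of_nat (i div m) ^ (k - 1)) =
        (\<Sum>d | d dvd i \<and> residue_in N S (i div d). \<epsilon> ^ d * of_nat d ^ (k - 1))"
    proof (rule sum.reindex_bij_witness[of _ "\<lambda>d. i div d" "\<lambda>m. i div m"])
      fix d assume d: "d \<in> {d. d dvd i \<and> residue_in N S (i div d)}"
      then show "i div d \<in> {m. m \<in> ?T \<and> m dvd i}"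
        using False assms(2) le_trans[OF div_le_dividend assms(2)]
        by (auto simp: small_parts_def Suc_le_eq div_greater_zero_iff dvd_imp_le intro: gr0I)
      show "i div (i div d) = d"
        using d False by (auto elim!: dvdE)
    next
      fix m assume m: "m \<in> {m. m \<in> ?T \<and> m dvd i}"
      show *: "i div (i div m) = m"
        using m False by (auto elim!: dvdE)
      show "i div m \<in> {d. d dvd i \<and> residue_in N S (i div d)}"
        using m * by (auto simp: small_parts_def)
    qed simp
    then show ?thesis using False by (simp add: eisenstein_def divisor_sum_def)
  qed
  finally show ?thesis by simp
qed

section \<open>The generating series and its coefficients\<close>

text \<open>
  Fixing the power \<open>q\<^sup>n\<close> leaves only the parts \<open>m \<le> n\<close>; over these, the product of the factors is
  the exponential of the sum of their exponents.
\<close>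

lemma macmahon_generating_series:
  "1 + (\<Sum>\<^sub>\<infinity>k\<in>{1..}. fps_const (macmahon N S \<epsilon> k) * fps_X ^ (2 * k)) =
    exp_series fps_const (macmahon_exponent fps_const (eisenstein N S \<epsilon>))"
proof (intro fps_ext)
  fix l n
  let ?T = "small_parts N S n"
  let ?x = "\<lambda>m k. polylog_series k oo (fps_const \<epsilon> * fps_X ^ m)"
  have "1 + fps_const (part_weight \<epsilon> m) * fps_X\<^sup>2 =
      exp_series fps_const (macmahon_exponent fps_const (?x m))" if "m \<in> ?T" for m
    unfolding part_weight_def using that by (intro macmahon_factor) (auto simp: small_parts_def)
  then have "(\<Prod>m\<in>?T. 1 + fps_const (part_weight \<epsilon> m) * fps_X\<^sup>2) =
      (\<Prod>m\<in>?T. exp_series fps_const (macmahon_exponent fps_const (?x m)))"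
    by (rule prod.cong[OF refl])
  also have "\<dots> = exp_series fps_const (macmahon_exponent fps_const (\<lambda>k. \<Sum>m\<in>?T. ?x m k))"
    by (simp add: macmahon_exponent_sum exp_series_sum macmahon_exponent_nth_0)
  also have "\<dots> $ l $ n = exp_series fps_const (macmahon_exponent fps_const (eisenstein N S \<epsilon>)) $ l $ n"
  proof (rule exp_series_coeff_cong)
    show "coeff_agree l n (macmahon_exponent fps_const (\<lambda>k. \<Sum>m\<in>?T. ?x m k))
        (macmahon_exponent fps_const (eisenstein N S \<epsilon>))"
      unfolding coeff_agree_def
    proof (intro allI impI)
      fix i j assume "j \<le> n"
      then have x: "eisenstein N S \<epsilon> (2 * r) $ s = (\<Sum>m\<in>?T. ?x m (2 * r)) $ s" if "1 \<le> r" "s \<le> j" for r s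
        using that by (intro eisenstein_nth_eq_sum_parts) auto
      show "macmahon_exponent fps_const (\<lambda>k. \<Sum>m\<in>?T. ?x m k) $ i $ j =
          macmahon_exponent fps_const (eisenstein N S \<epsilon>) $ i $ j"
        unfolding macmahon_exponent_nth[of fps_const, OF fps_const_0_eq_0] fps_sum_nth[of _ "{1..i}"]
        by (intro sum.cong refl) (simp add: x numeral_fps_const)
    qed
  qed
  finally show "(1 + (\<Sum>\<^sub>\<infinity>k\<in>{1..}. fps_const (macmahon N S \<epsilon> k) * fps_X ^ (2 * k))) $ l $ n =
      exp_series fps_const (macmahon_exponent fps_const (eisenstein N S \<epsilon>)) $ l $ n"
    by (simp only: macmahon_series_nth)
qed

text \<open>
  Evaluation at \<open>x\<close>, applied to the coefficients of the generating series of the \<open>\<Lambda>\<^sub>k\<close>, replaces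
  each variable in the exponent by its value.
\<close>

lemma mpoly_eval_Lambda_poly:
  "mpoly_eval fps_const x (Lambda_poly k) =
    exp_series fps_const (macmahon_exponent fps_const x) $ (2 * k)"
proof -
  interpret \<Phi>: ring_homomorphism "mpoly_eval (fps_const :: rat \<Rightarrow> rat fps) x"
    by (intro mpoly_eval_homomorphism fps_const_homomorphism)
  have "mpoly_eval fps_const x (Lambda_poly k) = fps_map (mpoly_eval fps_const x)
      (exp_series mpoly_const (macmahon_exponent mpoly_const mpoly_var)) $ (2 * k)"
    by (simp add: Lambda_poly_def macmahon_exponent_def)
  also have "\<dots> = exp_series fps_const (macmahon_exponent fps_const x) $ (2 * k)"
    by (subst \<Phi>.map_exp_series[where \<kappa> = fps_const], simp add: mpoly_eval_const fps_const_homomorphism)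
      (subst \<Phi>.map_macmahon_exponent[where \<kappa> = fps_const],
        simp_all add: mpoly_eval_const mpoly_eval_var fps_const_homomorphism, simp_all add: mpoly_const_def)
  finally show ?thesis .
qed

lemma exp_macmahon_exponent_cong:
  fixes x y :: "nat \<Rightarrow> rat fps"
  assumes "\<And>j. j \<in> {1..k} \<Longrightarrow> x (2 * j) = y (2 * j)"
  shows "exp_series fps_const (macmahon_exponent fps_const x) $ (2 * k) =
    exp_series fps_const (macmahon_exponent fps_const y) $ (2 * k)"
proof (rule fps_ext, rule exp_series_coeff_cong)
  fix n
  have "macmahon_exponent fps_const x $ l = macmahon_exponent fps_const y $ l" if "l \<le> 2 * k" for l
    unfolding macmahon_exponent_nth[of fps_const, OF fps_const_0_eq_0]
  proof (intro sum.cong refl)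
    fix j assume j: "j \<in> {1..l}"
    let ?c = "2 * fps_const ((-1) ^ (j - 1) / fact (2 * j) * (two_arcsin_half ^ (2 * j)) $ l) :: rat fps"
    show "?c * x (2 * j) = ?c * y (2 * j)"
    proof (cases "j \<le> k")
      case True
      then show ?thesis using assms[of j] j by simp
    next
      case False
      then show ?thesis using that by (simp add: two_arcsin_half_power_nth)
    qed
  qed
  then show "coeff_agree (2 * k) n (macmahon_exponent fps_const x) (macmahon_exponent fps_const y)"
    by (simp add: coeff_agree_def)
qed

theorem theorem3p4:
  fixes N :: nat and S :: "int set set" and \<epsilon> :: rat
  assumes "N > 0"
    and "S \<subseteq> carrier (ZFact (int N))" and "S \<noteq> {}"
    and "\<epsilon> \<in> {-1, 1}"
  shows "1 + (\<Sum>\<^sub>\<infinity>k\<in>{1..}. fps_const (macmahon N S \<epsilon> k) * fps_X ^ (2 * k)) =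
      exp_series fps_const
        (2 * (\<Sum>\<^sub>\<infinity>j\<in>{1..}.
           fps_base_change fps_const
             (fps_const ((-1) ^ (j - 1) / fact (2 * j)) * two_arcsin_half ^ (2 * j))
           * fps_const (eisenstein N S \<epsilon> (2 * j))))
    \<and> (\<forall>k\<ge>1. macmahon N S \<epsilon> k =
        mpoly_eval fps_const
          (\<lambda>i. if i \<in> (\<lambda>j. 2 * j) ` {1..k} then eisenstein N S \<epsilon> i else 0)
          (Lambda_poly k))"
proof (intro conjI allI impI)
  fix k :: nat assume "k \<ge> 1"
  let ?x = "\<lambda>i. if i \<in> (\<lambda>j. 2 * j) ` {1..k} then eisenstein N S \<epsilon> i else 0"
  have "macmahon N S \<epsilon> k =
      (1 + (\<Sum>\<^sub>\<infinity>k\<in>{1..}. fps_const (macmahon N S \<epsilon> k) * fps_X ^ (2 * k))) $ (2 * k)"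
    using \<open>k \<ge> 1\<close> by (subst even_series_nth) simp
  also have "\<dots> = exp_series fps_const (macmahon_exponent fps_const (eisenstein N S \<epsilon>)) $ (2 * k)"
    by (simp only: macmahon_generating_series)
  also have "\<dots> = exp_series fps_const (macmahon_exponent fps_const ?x) $ (2 * k)"
    by (rule exp_macmahon_exponent_cong) auto
  also have "\<dots> = mpoly_eval fps_const ?x (Lambda_poly k)"
    by (simp only: mpoly_eval_Lambda_poly)
  finally show "macmahon N S \<epsilon> k = mpoly_eval fps_const ?x (Lambda_poly k)" .
qed (rule macmahon_generating_series[unfolded macmahon_exponent_def])

end
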